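(* Let $D_n(t)=\sum_{\pi\in\mathfrak{D}_n}t^{\mathrm{des}(\pi)}=\sum_{k\geq1}d_{n,k}t^k$. Then for all $n\geq1$ and $1\leq k\leq n-1$, $$d_{2n,2n-k}< d_{2n,k}<d_{2n,2n-k-1}\quad\text{and}\quad d_{2n+1,k}< d_{2n+1,2n-k}< d_{2n+1,k+1},$$ except that $d_{4,1}=d_{4,2}=4$ (so the inequality $d_{4,1}<d_{4,2}$ does not hold). In particular, the polynomial $D_n(t)$ is unimodal for $n\geq2$.
   Context: $\mathfrak{D}_n$ is the set of derangements (fixed-point-free permutations) of $[n]=\{1,\dots,n\}$. For $\pi=\pi_1\cdots\pi_n$, $\mathrm{des}(\pi)=\#\{i\in[n-1]:\pi_i>\pi_{i+1}\}$. A polynomial $\sum h_it^i$ is unimodal if $h_0\le\cdots\le h_c\ge h_{c+1}\ge\cdots$ for some $c$. *)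

theory Defs
  imports "HOL-Combinatorics.Permutations" "HOL-Computational_Algebra.Polynomial"
begin

definition derangements :: "nat \<Rightarrow> (nat \<Rightarrow> nat) set" where
  "derangements n = {p. p permutes {1..n} \<and> (\<forall>i\<in>{1..n}. p i \<noteq> i)}"

definition des :: "nat \<Rightarrow> (nat \<Rightarrow> nat) \<Rightarrow> nat" where
  "des n p = card {i\<in>{1..n-1}. p i > p (Suc i)}"

definition Dpoly :: "nat \<Rightarrow> nat poly" where
  "Dpoly n = (\<Sum>p\<in>derangements n. monom 1 (des n p))"

definition dcoeff :: "nat \<Rightarrow> nat \<Rightarrow> nat" where
  "dcoeff n k = coeff (Dpoly n) k"

definition unimodal :: "'a::{zero,linorder} poly \<Rightarrow> bool" where
  "unimodal P \<longleftrightarrow> (\<exists>c. (\<forall>i<c. coeff P i \<le> coeff P (Suc i)) \<and>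
                         (\<forall>i\<ge>c. coeff P i \<ge> coeff P (Suc i)))"

end

theory Submission
  imports Defs
begin

text \<open>
  Everything follows from the recurrence
  $d_{n,k} = (k+1)\,d_{n-1,k} + (n-k)\,d_{n-1,k-1} + (-1)^n [k = n-1]$:
  it writes every difference in the spiral of inequalities for $n + 1$ as a nonnegative
  combination of differences in the spiral for $n$.

  For the recurrence, let $f_n(m)$ be the number of words of length $n$ over $m$ letters whose
  standardization is a derangement. Grouping the words by the permutation that sorts them stably
  gives $f_n(m) = \sum_k d_{n,k} \binom{n-1+m-k}{n}$. On the other hand, a letter $v$ can be inserted
  into a given word as a fixed point of the standardization with exactly one result, and this neither
  creates nor destroys fixed points with other letters. Hence the number $g_n(V)$ of words without
  fixed points at letters of $V$ satisfies $g_n(V \cup \{v\}) = g_n(V) - g_{n-1}(V)$, which yields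
  $f_n(m) = m\,f_{n-1}(m) + (-1)^n \binom{m}{n}$.
\<close>

section \<open>Inserting fixed letters into words\<close>

text \<open>Some occurrence of \<open>v\<close> in \<open>w\<close> is a fixed point of the standardization of \<open>w\<close>.\<close>

definition fixed_letter :: "'a::linorder \<Rightarrow> 'a list \<Rightarrow> bool" where
  "fixed_letter v w \<longleftrightarrow> (\<exists>xs ys. w = xs @ v # ys \<and>
     length (filter (\<lambda>x. v < x) xs) = length (filter (\<lambda>y. y < v) ys))"

definition inserts_fixed :: "'a::linorder \<Rightarrow> 'a list \<Rightarrow> 'a list \<Rightarrow> bool" where
  "inserts_fixed v w' w \<longleftrightarrow> (\<exists>xs ys. w' = xs @ ys \<and> w = xs @ v # ys \<and>
     length (filter (\<lambda>x. v < x) xs) = length (filter (\<lambda>y. y < v) ys))"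

lemma fixed_letter_iff_inserts: "fixed_letter v w \<longleftrightarrow> (\<exists>w'. inserts_fixed v w' w)"
  unfolding fixed_letter_def inserts_fixed_def by blast

text \<open>
  Moving the insertion point to the right changes the difference of the two counts by 0 (when it
  passes \<open>v\<close>) or 1, from a nonpositive to a nonnegative value. Therefore the admissible insertion
  points exist and are separated by letters \<open>v\<close> only.
\<close>

lemma inserts_fixed_exists: "\<exists>w. inserts_fixed v w' w"
proof -
  have "\<exists>xs ys. zs = xs @ ys \<and>
     c + length (filter (\<lambda>x. v < x) xs) = length (filter (\<lambda>y. y < v) ys)"
    if "c \<le> length (filter (\<lambda>y. y < v) zs)" for c zs
    using that
  proof (induction zs arbitrary: c)
    case Nil
    then show ?case by simp
  next
    case (Cons z zs)
    show ?case
    proof (cases "c = length (filter (\<lambda>y. y < v) (z # zs))")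
      case True
      then show ?thesis by (intro exI[of _ "[]"] exI[of _ "z # zs"]) simp
    next
      case False
      with Cons.prems have "c + (if v < z then 1 else 0) \<le> length (filter (\<lambda>y. y < v) zs)"
        by (auto split: if_splits)
      from Cons.IH[OF this] obtain xs ys where "zs = xs @ ys"
        "c + (if v < z then 1 else 0) + length (filter (\<lambda>x. v < x) xs) = length (filter (\<lambda>y. y < v) ys)"
        by blast
      then show ?thesis by (intro exI[of _ "z # xs"] exI[of _ ys]) auto
    qed
  qed
  from this[of 0 w'] show ?thesis unfolding inserts_fixed_def by auto
qed

lemma filter_neither_imp_replicate:
  fixes v :: "'a::linorder"
  assumes "filter (\<lambda>x. v < x) zs = []" "filter (\<lambda>x. x < v) zs = []"
  shows "zs = replicate (length zs) v"
  using assms by (intro replicate_eqI refl) (force simp: filter_empty_conv)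

lemma inserts_fixed_right_unique:
  assumes "inserts_fixed v w' w\<^sub>1" "inserts_fixed v w' w\<^sub>2"
  shows "w\<^sub>1 = w\<^sub>2"
proof -
  have *: "as @ v # bs = xs @ v # ys"
    if "xs = as @ zs" "bs = zs @ ys"
      "length (filter (\<lambda>x. v < x) as) = length (filter (\<lambda>y. y < v) bs)"
      "length (filter (\<lambda>x. v < x) xs) = length (filter (\<lambda>y. y < v) ys)" for as bs xs ys zs
  proof -
    have "zs = replicate (length zs) v"
      using that by (intro filter_neither_imp_replicate) auto
    then have "v # zs = zs @ [v]"
      by (metis replicate_append_same)
    then show ?thesis using that by (metis append.assoc append_Cons append_Nil)
  qed
  from assms obtain as bs xs ys where 1: "w' = as @ bs" "w\<^sub>1 = as @ v # bs"
      "length (filter (\<lambda>x. v < x) as) = length (filter (\<lambda>y. y < v) bs)"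
     and 2: "w' = xs @ ys" "w\<^sub>2 = xs @ v # ys"
      "length (filter (\<lambda>x. v < x) xs) = length (filter (\<lambda>y. y < v) ys)"
    unfolding inserts_fixed_def by metis
  from 1 2 have "(\<exists>zs. xs = as @ zs \<and> bs = zs @ ys) \<or> (\<exists>zs. as = xs @ zs \<and> ys = zs @ bs)"
    by (metis append_eq_append_conv2)
  then show ?thesis using 1 2 *[of xs as _ bs ys] *[of as xs _ ys bs] by metis
qed

lemma inserts_fixed_left_unique:
  assumes "inserts_fixed v w\<^sub>1 w" "inserts_fixed v w\<^sub>2 w"
  shows "w\<^sub>1 = w\<^sub>2"
proof -
  have *: "as @ bs = xs @ ys"
    if "xs @ v # ys = as @ v # bs" "xs = as @ zs"
      "length (filter (\<lambda>x. v < x) as) = length (filter (\<lambda>y. y < v) bs)"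
      "length (filter (\<lambda>x. v < x) xs) = length (filter (\<lambda>y. y < v) ys)" for as bs xs ys zs
  proof -
    have e: "v # bs = zs @ v # ys" using that by simp
    show ?thesis
    proof (cases zs)
      case Nil
      then show ?thesis using that e by simp
    next
      case (Cons z us)
      then have us: "z = v" "bs = us @ v # ys" using e by auto
      have "us = replicate (length us) v"
        using that us Cons by (intro filter_neither_imp_replicate) auto
      then have "v # us = us @ [v]"
        by (metis replicate_append_same)
      then show ?thesis using that us Cons by (metis append.assoc append_Cons append_Nil)
    qed
  qed
  from assms obtain as bs xs ys where 1: "w\<^sub>1 = as @ bs" "w = as @ v # bs"
      "length (filter (\<lambda>x. v < x) as) = length (filter (\<lambda>y. y < v) bs)"
     and 2: "w\<^sub>2 = xs @ ys" "w = xs @ v # ys"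
      "length (filter (\<lambda>x. v < x) xs) = length (filter (\<lambda>y. y < v) ys)"
    unfolding inserts_fixed_def by auto
  from 1 2 have "(\<exists>zs. xs = as @ zs) \<or> (\<exists>zs. as = xs @ zs)"
    by (metis append_eq_append_conv2)
  then show ?thesis using 1 2 *[of xs ys as bs] *[of as bs xs ys] by metis
qed

lemma length_filter_mono:
  assumes "\<And>x. x \<in> set xs \<Longrightarrow> P x \<Longrightarrow> Q x"
  shows "length (filter P xs) \<le> length (filter Q xs)"
  using assms by (induction xs) (auto simp: le_SucI)

lemma fixed_letter_split:
  "fixed_letter u (xs @ ys) \<longleftrightarrow>
    (\<exists>as bs. xs = as @ u # bs \<and> length (filter (\<lambda>x. u < x) as)
       = length (filter (\<lambda>y. y < u) bs) + length (filter (\<lambda>y. y < u) ys)) \<or>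
    (\<exists>as bs. ys = as @ u # bs \<and> length (filter (\<lambda>y. y < u) bs)
       = length (filter (\<lambda>x. u < x) xs) + length (filter (\<lambda>y. u < y) as))"
  (is "_ = (?L \<or> ?R)")
proof
  assume "fixed_letter u (xs @ ys)"
  then obtain as bs where w: "xs @ ys = as @ u # bs"
    "length (filter (\<lambda>x. u < x) as) = length (filter (\<lambda>y. y < u) bs)"
    unfolding fixed_letter_def by auto
  from w(1) consider us where "xs = as @ us" "us @ ys = u # bs" | us where "as = xs @ us" "ys = us @ u # bs"
    by (auto simp: append_eq_append_conv2)
  then show "?L \<or> ?R"
  proof cases
    case 1
    show ?thesis
    proof (cases us)
      case Nil
      then have ?R using 1 w by (intro exI[of _ "[]"] exI[of _ bs]) auto
      then show ?thesis ..
    next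
      case (Cons a cs)
      then have ?L using 1 w by (intro exI[of _ as] exI[of _ cs]) auto
      then show ?thesis ..
    qed
  next
    case 2
    then have ?R using w by (intro exI[of _ us] exI[of _ bs]) auto
    then show ?thesis ..
  qed
next
  assume "?L \<or> ?R"
  then show "fixed_letter u (xs @ ys)"
  proof
    assume ?L
    then obtain as bs where "xs = as @ u # bs" "length (filter (\<lambda>x. u < x) as)
       = length (filter (\<lambda>y. y < u) bs) + length (filter (\<lambda>y. y < u) ys)" by blast
    then show ?thesis unfolding fixed_letter_def by (intro exI[of _ as] exI[of _ "bs @ ys"]) auto
  next
    assume ?R
    then obtain as bs where "ys = as @ u # bs" "length (filter (\<lambda>y. y < u) bs)
       = length (filter (\<lambda>x. u < x) xs) + length (filter (\<lambda>y. u < y) as)" by blast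
    then show ?thesis unfolding fixed_letter_def by (intro exI[of _ "xs @ as"] exI[of _ bs]) auto
  qed
qed

lemma inserts_fixed_preserves:
  assumes "inserts_fixed v w' w" "u \<noteq> v"
  shows "fixed_letter u w \<longleftrightarrow> fixed_letter u w'"
proof -
  from assms obtain xs ys where w: "w' = xs @ ys" "w = xs @ v # ys"
    and c: "length (filter (\<lambda>x. v < x) xs) = length (filter (\<lambda>y. y < v) ys)"
    unfolding inserts_fixed_def by auto
  have left: "u < v" if "xs = as @ u # bs" "length (filter (\<lambda>y. y < u) ys) \<le> length (filter (\<lambda>x. u < x) as)" for as bs
  proof (rule ccontr)
    assume "\<not> u < v"
    then have "v < u" using assms by auto
    then have "length (filter (\<lambda>y. y < v) ys) \<le> length (filter (\<lambda>y. y < u) ys)"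
       "length (filter (\<lambda>x. u < x) as) < length (filter (\<lambda>x. v < x) xs)"
      unfolding that(1) by (auto intro!: length_filter_mono trans_le_add1 simp: less_Suc_eq_le)
    then show False using c that by linarith
  qed
  have right: "v < u" if "ys = as @ u # bs" "length (filter (\<lambda>x. u < x) xs) \<le> length (filter (\<lambda>y. y < u) bs)" for as bs
  proof (rule ccontr)
    assume "\<not> v < u"
    then have "u < v" using assms by auto
    then have "length (filter (\<lambda>y. v < y) xs) \<le> length (filter (\<lambda>y. u < y) xs)"
       "length (filter (\<lambda>x. x < u) bs) < length (filter (\<lambda>x. x < v) ys)"
      unfolding that(1) by (auto intro!: length_filter_mono trans_le_add2 simp: less_Suc_eq_le)
    then show False using c that by linarith
  qed
  have split: "fixed_letter u (xs @ v # ys) \<longleftrightarrow>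
    (\<exists>as bs. xs = as @ u # bs \<and> length (filter (\<lambda>x. u < x) as)
       = length (filter (\<lambda>y. y < u) bs) + length (filter (\<lambda>y. y < u) (v # ys))) \<or>
    (\<exists>as bs. ys = as @ u # bs \<and> length (filter (\<lambda>y. y < u) bs)
       = length (filter (\<lambda>x. u < x) (xs @ [v])) + length (filter (\<lambda>y. u < y) as))"
    (is "_ = (?L \<or> ?R)")
  proof -
    have "?L \<longrightarrow> fixed_letter u (xs @ v # ys)" using fixed_letter_split[of u xs "v # ys"] by simp
    moreover have "?R \<longrightarrow> fixed_letter u (xs @ v # ys)" using fixed_letter_split[of u "xs @ [v]" ys] by simp
    moreover have "fixed_letter u (xs @ v # ys) \<longrightarrow> ?L \<or> ?R"
      unfolding fixed_letter_split using assms by (auto simp: Cons_eq_append_conv)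
    ultimately show ?thesis by blast
  qed
  have "(length (filter (\<lambda>x. u < x) as) = length (filter (\<lambda>y. y < u) bs) + length (filter (\<lambda>y. y < u) (v # ys)))
     \<longleftrightarrow> (length (filter (\<lambda>x. u < x) as) = length (filter (\<lambda>y. y < u) bs) + length (filter (\<lambda>y. y < u) ys))"
     if "xs = as @ u # bs" for as bs
    using left[OF that] by auto
  moreover have "(length (filter (\<lambda>y. y < u) bs) = length (filter (\<lambda>x. u < x) (xs @ [v])) + length (filter (\<lambda>y. u < y) as))
     \<longleftrightarrow> (length (filter (\<lambda>y. y < u) bs) = length (filter (\<lambda>x. u < x) xs) + length (filter (\<lambda>y. u < y) as))"
     if "ys = as @ u # bs" for as bs
    using right[OF that] by auto
  ultimately show ?thesis unfolding w split unfolding fixed_letter_split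
    by (intro arg_cong2[where f = "(\<or>)"] ex_cong1 conj_cong refl)
qed

definition words_avoiding :: "nat \<Rightarrow> nat \<Rightarrow> nat set \<Rightarrow> nat list set" where
  "words_avoiding n m V =
     {w. set w \<subseteq> {..<m} \<and> length w = n \<and> (\<forall>u\<in>V. \<not> fixed_letter u w)}"

lemma finite_words_avoiding: "finite (words_avoiding n m V)"
  by (rule finite_subset[OF _ finite_lists_length_eq[of "{..<m}" n]]) (auto simp: words_avoiding_def)

lemma card_words_avoiding_Suc:
  assumes "v < m" "v \<notin> V"
  shows "card (words_avoiding (Suc n) m V)
    = card (words_avoiding (Suc n) m (insert v V)) + card (words_avoiding n m V)"
proof -
  let ?B = "{w \<in> words_avoiding (Suc n) m V. fixed_letter v w}"
  define f where "f w' = (SOME w. inserts_fixed v w' w)" for w'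
  have f: "inserts_fixed v w' (f w')" for w'
    unfolding f_def using inserts_fixed_exists by (rule someI_ex)
  have iff: "w \<in> ?B \<longleftrightarrow> w' \<in> words_avoiding n m V" if ins: "inserts_fixed v w' w" for w w'
  proof -
    have "fixed_letter v w" using ins fixed_letter_iff_inserts by blast
    moreover have "fixed_letter u w \<longleftrightarrow> fixed_letter u w'" if "u \<in> V" for u
      using inserts_fixed_preserves[OF ins] that assms by metis
    moreover have "set w = insert v (set w')" "length w = Suc (length w')"
      using ins unfolding inserts_fixed_def by auto
    ultimately show ?thesis using assms unfolding words_avoiding_def by auto
  qed
  have "bij_betw f (words_avoiding n m V) ?B"
    unfolding bij_betw_def
  proof
    show "inj_on f (words_avoiding n m V)"
      by (rule inj_onI) (metis f inserts_fixed_left_unique)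
    show "f ` words_avoiding n m V = ?B"
    proof
      show "f ` words_avoiding n m V \<subseteq> ?B" using iff f by blast
      show "?B \<subseteq> f ` words_avoiding n m V"
      proof
        fix w assume w: "w \<in> ?B"
        then obtain w' where "inserts_fixed v w' w" using fixed_letter_iff_inserts by blast
        with w show "w \<in> f ` words_avoiding n m V"
          using iff f inserts_fixed_right_unique by (metis (no_types, lifting) image_eqI)
      qed
    qed
  qed
  then have "card ?B = card (words_avoiding n m V)" by (simp add: bij_betw_same_card)
  moreover have "words_avoiding (Suc n) m V = words_avoiding (Suc n) m (insert v V) \<union> ?B"
    "words_avoiding (Suc n) m (insert v V) \<inter> ?B = {}"
    unfolding words_avoiding_def by auto
  ultimately show ?thesis
    by (metis (no_types, lifting) card_Un_disjoint finite_words_avoiding finite_Un)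
qed

lemma words_avoiding_0: "words_avoiding 0 m V = {[]}"
  unfolding words_avoiding_def fixed_letter_def by auto

lemma card_words_avoiding_rec:
  assumes "finite V" "V \<subseteq> {..<m}"
  shows "int (card (words_avoiding (Suc n) m V))
    = int m * int (card (words_avoiding n m V)) + (-1) ^ Suc n * int (card V choose Suc n)"
  using assms
proof (induction V arbitrary: n rule: finite_induct)
  case empty
  have "card (words_avoiding n m {}) = m ^ n" for n
    using card_lists_length_eq[of "{..<m}" n] by (simp add: words_avoiding_def)
  then show ?case by simp
next
  case (insert v V)
  have v: "v < m" "v \<notin> V" and IH: "int (card (words_avoiding (Suc n) m V))
    = int m * int (card (words_avoiding n m V)) + (-1) ^ Suc n * int (card V choose Suc n)" for n
    using insert by auto
  have rec: "int (card (words_avoiding (Suc n) m (insert v V)))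
     = int (card (words_avoiding (Suc n) m V)) - int (card (words_avoiding n m V))" for n
    using card_words_avoiding_Suc[OF v, of n] by simp
  show ?case
  proof (cases n)
    case 0
    then show ?thesis using insert.hyps IH[of 0] rec[of 0] by (simp add: words_avoiding_0)
  next
    case (Suc k)
    have "int m * int (card (words_avoiding n m (insert v V)))
      = int m * int (card (words_avoiding n m V)) - int m * int (card (words_avoiding k m V))"
      unfolding Suc rec by (simp only: right_diff_distrib)
    then show ?thesis using insert.hyps IH[of n] IH[of k] rec[of n] Suc
      by (simp add: algebra_simps)
  qed
qed

section \<open>Standardization\<close>

definition rank :: "nat \<Rightarrow> (nat \<Rightarrow> 'a::linorder) \<Rightarrow> nat \<Rightarrow> nat" where
  "rank n f q = card {r \<in> {1..n}. f r \<le> f q}"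

lemma rank_less:
  assumes "r \<in> {1..n}" "f q < f r"
  shows "rank n f q < rank n f r"
proof -
  have "{s \<in> {1..n}. f s \<le> f q} \<subseteq> {s \<in> {1..n}. f s \<le> f r} - {r}"
    using assms by auto
  also have "\<dots> \<subset> {s \<in> {1..n}. f s \<le> f r}"
    using assms by auto
  finally show ?thesis
    unfolding rank_def by (intro psubset_card_mono) simp_all
qed

lemma inj_on_rank:
  assumes "inj_on f {1..n}"
  shows "inj_on (rank n f) {1..n}"
proof (rule inj_onI, rule ccontr)
  fix q r assume "q \<in> {1..n}" "r \<in> {1..n}" "rank n f q = rank n f r" "q \<noteq> r"
  moreover from this assms have "f q \<noteq> f r" by (auto dest: inj_onD)
  ultimately show False
    using rank_less[of q n f r] rank_less[of r n f q] by (auto simp: neq_iff)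
qed

lemma strict_mono_on_permuted_iff:
  assumes p: "p permutes {1..n}"
  shows "strict_mono_on {1..n} (\<lambda>i. f (p i)) \<longleftrightarrow> (\<forall>i\<in>{1..n}. rank n f (p i) = i)"
proof
  assume mono: "strict_mono_on {1..n} (\<lambda>i. f (p i))"
  show "\<forall>i\<in>{1..n}. rank n f (p i) = i"
  proof
    fix i assume i: "i \<in> {1..n}"
    have "{r \<in> p ` {1..n}. f r \<le> f (p i)} = p ` {j \<in> {1..n}. f (p j) \<le> f (p i)}"
      by blast
    then have "{r \<in> {1..n}. f r \<le> f (p i)} = p ` {j \<in> {1..n}. f (p j) \<le> f (p i)}"
      unfolding permutes_image[OF p] .
    also have "{j \<in> {1..n}. f (p j) \<le> f (p i)} = {1..i}"
    proof -
      have "f (p j) \<le> f (p i) \<longleftrightarrow> j \<le> i" if "j \<in> {1..n}" for j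
        using strict_mono_on_less_eq[OF mono that i] .
      then show ?thesis using i by auto
    qed
    also have "card (p ` {1..i}) = i"
      using permutes_inj[OF p] by (simp add: card_image inj_on_subset)
    finally show "rank n f (p i) = i" unfolding rank_def .
  qed
next
  assume *: "\<forall>i\<in>{1..n}. rank n f (p i) = i"
  show "strict_mono_on {1..n} (\<lambda>i. f (p i))"
  proof (rule strict_mono_onI, rule ccontr)
    fix i j assume ij: "i \<in> {1..n}" "j \<in> {1..n}" "i < j" "\<not> f (p i) < f (p j)"
    then have "rank n f (p j) \<le> rank n f (p i)"
      unfolding rank_def by (intro card_mono) auto
    with * ij show False by auto
  qed
qed

lemma ex1_sorting_permutation:
  fixes f :: "nat \<Rightarrow> 'a::linorder"
  assumes "inj_on f {1..n}"
  shows "\<exists>!p. p permutes {1..n} \<and> strict_mono_on {1..n} (\<lambda>i. f (p i))"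
proof (rule ex_ex1I)
  let ?s = "\<lambda>q. if q \<in> {1..n} then rank n f q else q"
  have sub: "rank n f ` {1..n} \<subseteq> {1..n}"
  proof (rule image_subsetI)
    fix q assume q: "q \<in> {1..n}"
    have "rank n f q \<le> card {1..n}"
      unfolding rank_def by (rule card_mono) auto
    moreover have "rank n f q > 0"
      using q unfolding rank_def by (auto simp: card_gt_0_iff)
    ultimately show "rank n f q \<in> {1..n}" by simp
  qed
  then have "rank n f ` {1..n} = {1..n}"
    using inj_on_rank[OF assms] by (intro endo_inj_surj) auto
  then have "bij_betw ?s {1..n} {1..n}"
    using inj_on_rank[OF assms] bij_betw_cong[of "{1..n}" ?s "rank n f" "{1..n}"]
    by (simp add: bij_betw_def)
  then have s: "?s permutes {1..n}"
    by (rule bij_imp_permutes) auto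
  have "rank n f (inv ?s i) = i" if "i \<in> {1..n}" for i
  proof -
    have "inv ?s i \<in> {1..n}" using permutes_in_image[OF permutes_inv[OF s]] that by blast
    moreover have "?s (inv ?s i) = i" by (rule permutes_inverses(1)[OF s])
    ultimately show ?thesis by simp
  qed
  then show "\<exists>p. p permutes {1..n} \<and> strict_mono_on {1..n} (\<lambda>i. f (p i))"
    using permutes_inv[OF s] strict_mono_on_permuted_iff[OF permutes_inv[OF s]] by blast
next
  fix p q
  assume "p permutes {1..n} \<and> strict_mono_on {1..n} (\<lambda>i. f (p i))"
     and "q permutes {1..n} \<and> strict_mono_on {1..n} (\<lambda>i. f (q i))"
  then have pq: "p permutes {1..n}" "q permutes {1..n}"
    and r: "\<forall>i\<in>{1..n}. rank n f (p i) = i" "\<forall>i\<in>{1..n}. rank n f (q i) = i"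
    using strict_mono_on_permuted_iff by blast+
  show "p = q"
  proof
    fix i
    show "p i = q i"
    proof (cases "i \<in> {1..n}")
      case True
      moreover from this have "p i \<in> {1..n}" "q i \<in> {1..n}"
        using permutes_in_image[OF pq(1)] permutes_in_image[OF pq(2)] by simp_all
      ultimately show ?thesis
        using inj_onD[OF inj_on_rank[OF assms], of "p i" "q i"] r by simp
    next
      case False
      then show ?thesis using permutes_not_in[OF pq(1)] permutes_not_in[OF pq(2)] by simp
    qed
  qed
qed

text \<open>Encodes the lexicographic order on pairs of a letter and its (1-based) position.\<close>

definition pos_key :: "nat list \<Rightarrow> nat \<Rightarrow> nat" where
  "pos_key w q = w ! (q - 1) * Suc (length w) + q"

lemma pos_key_less_iff:
  assumes "q \<in> {1..length w}" "r \<in> {1..length w}"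
  shows "pos_key w q < pos_key w r \<longleftrightarrow>
    w ! (q - 1) < w ! (r - 1) \<or> w ! (q - 1) = w ! (r - 1) \<and> q < r"
proof -
  have less: "pos_key w q < pos_key w r" if "w ! (q - 1) < w ! (r - 1)"
    "q \<in> {1..length w}" "r \<in> {1..length w}" for q r
  proof -
    have "pos_key w q < Suc (w ! (q - 1)) * Suc (length w)"
      using that unfolding pos_key_def by simp
    also have "\<dots> \<le> w ! (r - 1) * Suc (length w)"
      using that by (intro mult_le_mono1) simp
    finally show ?thesis unfolding pos_key_def by simp
  qed
  show ?thesis
    using less[of q r] less[of r q] assms
    by (cases "w ! (q - 1)" "w ! (r - 1)" rule: linorder_cases) (auto simp: pos_key_def)
qed

lemma pos_key_le_iff:
  assumes "q \<in> {1..length w}" "r \<in> {1..length w}"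
  shows "pos_key w q \<le> pos_key w r \<longleftrightarrow>
    w ! (q - 1) < w ! (r - 1) \<or> w ! (q - 1) = w ! (r - 1) \<and> q \<le> r"
  using pos_key_less_iff[OF assms(2,1)] by (auto simp: not_less[symmetric])

lemma inj_on_pos_key: "inj_on (pos_key w) {1..length w}"
proof (rule inj_onI)
  fix q r assume qr: "q \<in> {1..length w}" "r \<in> {1..length w}" "pos_key w q = pos_key w r"
  then show "q = r"
    using pos_key_le_iff[OF qr(1,2)] pos_key_le_iff[OF qr(2,1)] by auto
qed

definition sorts :: "(nat \<Rightarrow> nat) \<Rightarrow> nat list \<Rightarrow> bool" where
  "sorts p w \<longleftrightarrow> p permutes {1..length w} \<and> strict_mono_on {1..length w} (\<lambda>i. pos_key w (p i))"

lemma ex1_sorts: "\<exists>!p. sorts p w"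
  unfolding sorts_def using ex1_sorting_permutation[OF inj_on_pos_key] .

lemma card_pos_filter:
  "card {r \<in> {a<..a + length xs}. P (xs ! (r - Suc a))} = length (filter P xs)"
proof -
  have "{r \<in> {a<..a + length xs}. P (xs ! (r - Suc a))} = (\<lambda>j. Suc (a + j)) ` {j. j < length xs \<and> P (xs ! j)}"
    (is "?L = ?f ` ?R")
  proof
    show "?L \<subseteq> ?f ` ?R"
    proof
      fix r assume "r \<in> ?L"
      then show "r \<in> ?f ` ?R" by (intro image_eqI[of _ _ "r - Suc a"]) auto
    qed
  qed auto
  then show ?thesis by (simp add: card_image inj_on_def length_filter_conv_card)
qed

lemma rank_pos_key_eq_iff:
  "rank (length (xs @ v # ys)) (pos_key (xs @ v # ys)) (Suc (length xs)) = Suc (length xs) \<longleftrightarrow>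
   length (filter (\<lambda>x. v < x) xs) = length (filter (\<lambda>y. y < v) ys)"
proof -
  define w where "w = xs @ v # ys"
  define i where "i = Suc (length xs)"
  have wi: "w ! (i - 1) = v" and i: "i \<in> {1..length w}" by (simp_all add: w_def i_def)
  let ?A = "{r \<in> {1..i}. w ! (r - 1) \<le> v}" and ?B = "{r \<in> {1..i}. v < w ! (r - 1)}"
    and ?C = "{r \<in> {i<..length w}. w ! (r - 1) < v}"
  have "{r \<in> {1..length w}. pos_key w r \<le> pos_key w i} = ?A \<union> ?C"
    using i using wi by (auto simp: pos_key_le_iff)
  then have "rank (length w) (pos_key w) i = card ?A + card ?C"
    unfolding rank_def by (subst card_Un_disjoint[symmetric]) auto
  moreover have "i = card ?A + card ?B"
  proof -
    have "card (?A \<union> ?B) = card ?A + card ?B" by (rule card_Un_disjoint) auto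
    moreover have "?A \<union> ?B = {1..i}" by auto
    ultimately show ?thesis by simp
  qed
  moreover have "card ?B = length (filter (\<lambda>x. v < x) xs)"
  proof -
    have "?B = {r \<in> {0<..0 + length xs}. v < xs ! (r - Suc 0)}"
      by (auto simp: w_def i_def nth_append split: if_splits)
    then show ?thesis using card_pos_filter[of 0 xs "\<lambda>x. v < x"] by simp
  qed
  moreover have "card ?C = length (filter (\<lambda>y. y < v) ys)"
  proof -
    have "?C = {r \<in> {i<..i + length ys}. ys ! (r - Suc i) < v}"
    proof -
      have "w ! (r - 1) = ys ! (r - Suc i)" if ri: "r > i" for r
      proof -
        obtain k where "r = Suc (i + k)" using less_imp_Suc_add[OF ri] by blast
        then show ?thesis by (simp add: w_def i_def nth_append)
      qed
      then show ?thesis by (auto simp: w_def i_def)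
    qed
    then show ?thesis using card_pos_filter[of i ys "\<lambda>y. y < v"] by simp
  qed
  ultimately show ?thesis unfolding w_def i_def by linarith
qed

lemma sorts_fixed_point_iff:
  assumes "sorts p w"
  shows "(\<exists>i\<in>{1..length w}. p i = i) \<longleftrightarrow> (\<exists>v. fixed_letter v w)"
proof -
  have p: "p permutes {1..length w}" and r: "\<And>i. i \<in> {1..length w} \<Longrightarrow> rank (length w) (pos_key w) (p i) = i"
    using assms strict_mono_on_permuted_iff[of p "length w"] unfolding sorts_def by blast+
  have "p i = i \<longleftrightarrow> rank (length w) (pos_key w) i = i" if i: "i \<in> {1..length w}" for i
    using r[OF i] inj_onD[OF inj_on_rank[OF inj_on_pos_key], of w "p i" i] i permutes_in_image[OF p]
    by metis
  then have "(\<exists>i\<in>{1..length w}. p i = i) \<longleftrightarrow> (\<exists>i\<in>{1..length w}. rank (length w) (pos_key w) i = i)"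
    by blast
  also have "\<dots> \<longleftrightarrow> (\<exists>v. fixed_letter v w)"
  proof
    assume "\<exists>i\<in>{1..length w}. rank (length w) (pos_key w) i = i"
    then obtain i where i: "i \<in> {1..length w}" "rank (length w) (pos_key w) i = i" by blast
    define xs where "xs = take (i - 1) w"
    define v where "v = w ! (i - 1)"
    define ys where "ys = drop i w"
    have "w = xs @ v # ys" "i = Suc (length xs)"
      using i id_take_nth_drop[of "i - 1" w] by (auto simp: xs_def ys_def v_def)
    then show "\<exists>v. fixed_letter v w"
      using i rank_pos_key_eq_iff[of xs v ys] unfolding fixed_letter_def by metis
  next
    assume "\<exists>v. fixed_letter v w"
    then obtain xs v ys where "w = xs @ v # ys"
      "length (filter (\<lambda>x. v < x) xs) = length (filter (\<lambda>y. y < v) ys)"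
      unfolding fixed_letter_def by blast
    then show "\<exists>i\<in>{1..length w}. rank (length w) (pos_key w) i = i"
      using rank_pos_key_eq_iff[of xs v ys] by (intro bexI[of _ "Suc (length xs)"]) auto
  qed
  finally show ?thesis .
qed

section \<open>Words sorted by a given permutation\<close>

definition chains :: "(nat \<Rightarrow> bool) \<Rightarrow> nat \<Rightarrow> nat \<Rightarrow> nat list set" where
  "chains R n m = {s. set s \<subseteq> {..<m} \<and> length s = n \<and>
     (\<forall>i. Suc i < n \<longrightarrow> s ! i \<le> s ! Suc i \<and> (R i \<longrightarrow> s ! i < s ! Suc i))}"

lemma finite_chains: "finite (chains R n m)"
  by (rule finite_subset[OF _ finite_lists_length_eq[of "{..<m}" n]]) (auto simp: chains_def)

lemma chains_nth_le_last:
  assumes "s \<in> chains R (Suc n) m" "i \<le> n"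
  shows "s ! i \<le> s ! n"
  using assms(2)
proof (induction rule: inc_induct)
  case (step k)
  then have "s ! k \<le> s ! Suc k" using assms(1) by (auto simp: chains_def)
  with step show ?case by linarith
qed simp

lemma snoc_mem_chains_iff:
  "s @ [x] \<in> chains R (Suc (Suc n)) m \<longleftrightarrow>
     s \<in> chains R (Suc n) m \<and> x < m \<and> s ! n \<le> x \<and> (R n \<longrightarrow> s ! n < x)"
  (is "?L \<longleftrightarrow> ?R")
proof
  assume L: ?L
  then have len: "length s = Suc n" by (simp add: chains_def)
  have step: "(s @ [x]) ! i \<le> (s @ [x]) ! Suc i \<and> (R i \<longrightarrow> (s @ [x]) ! i < (s @ [x]) ! Suc i)" if "i \<le> n" for i
    using L that by (auto simp: chains_def)
  have "s ! i \<le> s ! Suc i \<and> (R i \<longrightarrow> s ! i < s ! Suc i)" if "i < n" for i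
    using step[of i] that len by (simp add: nth_append)
  moreover have "s ! n \<le> x \<and> (R n \<longrightarrow> s ! n < x)"
    using step[of n] len by (simp add: nth_append)
  ultimately show ?R using L len by (simp add: chains_def)
next
  assume R: ?R
  then have len: "length s = Suc n" by (simp add: chains_def)
  have "(s @ [x]) ! i \<le> (s @ [x]) ! Suc i \<and> (R i \<longrightarrow> (s @ [x]) ! i < (s @ [x]) ! Suc i)" if "i \<le> n" for i
  proof (cases "i = n")
    case True
    then show ?thesis using R len by (simp add: nth_append)
  next
    case False
    then show ?thesis using R len that by (simp add: nth_append chains_def)
  qed
  then show ?L using R len by (simp add: chains_def)
qed

lemma chains_Suc_Suc:
  "chains R (Suc (Suc n)) (Suc m) = chains R (Suc (Suc n)) m \<union>
     (\<lambda>s. s @ [m]) ` chains R (Suc n) (if R n then m else Suc m)"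
proof (rule set_eqI)
  fix t
  let ?M = "if R n then m else Suc m"
  show "t \<in> chains R (Suc (Suc n)) (Suc m) \<longleftrightarrow> t \<in> chains R (Suc (Suc n)) m \<union> (\<lambda>s. s @ [m]) ` chains R (Suc n) ?M"
  proof (cases "length t = Suc (Suc n)")
    case False
    then show ?thesis by (auto simp: chains_def)
  next
    case True
    then obtain s x where t: "t = s @ [x]" and len: "length s = Suc n"
      by (metis length_Suc_conv_rev)
    have chain_bound: "s \<in> chains R (Suc n) M' \<longleftrightarrow> s ! n < M'"
      if "s \<in> chains R (Suc n) M" for M M'
    proof -
      have "(\<forall>i<Suc n. s ! i < M') \<longleftrightarrow> s ! n < M'"
        using chains_nth_le_last[OF that] by (auto simp: less_Suc_eq_le intro: le_less_trans)
      then show ?thesis using that len by (auto simp: chains_def subset_iff in_set_conv_nth)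
    qed
    have sub: "s \<in> chains R (Suc n) (Suc m)" if "s \<in> chains R (Suc n) M" "M \<le> Suc m" for M
      using that by (auto simp: chains_def)
    have mem: "s \<in> chains R (Suc n) M \<longleftrightarrow> s \<in> chains R (Suc n) (Suc m) \<and> s ! n < M"
      if "M \<le> Suc m" for M
      using chain_bound[of "Suc m" M] chain_bound[of M M] sub[OF _ that] by blast
    have "s @ [x] \<in> (\<lambda>s. s @ [m]) ` chains R (Suc n) ?M \<longleftrightarrow> x = m \<and> s \<in> chains R (Suc n) ?M"
      by blast
    also have "\<dots> \<longleftrightarrow> x = m \<and> s \<in> chains R (Suc n) (Suc m) \<and> s ! n \<le> m \<and> (R n \<longrightarrow> s ! n < m)"
      using mem[of ?M] by auto
    finally show ?thesis
      unfolding t Un_iff snoc_mem_chains_iff using mem[of m] by auto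
  qed
qed

lemma card_chains:
  "card (chains R (Suc n) m) = (n + m - card {i. i < n \<and> R i}) choose Suc n"
proof (induction n arbitrary: m)
  case 0
  have "chains R (Suc 0) m = (\<lambda>x. [x]) ` {..<m}"
    by (auto simp: chains_def length_Suc_conv)
  then show ?case by (simp add: card_image inj_on_def)
next
  case (Suc n)
  note outer = Suc
  let ?D = "card {i. i < n \<and> R i}"
  have D: "?D \<le> n" using card_mono[of "{..<n}" "{i. i < n \<and> R i}"] by auto
  have "{i. i < Suc n \<and> R i} = (if R n then insert n {i. i < n \<and> R i} else {i. i < n \<and> R i})"
    by (auto simp: less_Suc_eq)
  then have D': "card {i. i < Suc n \<and> R i} = ?D + (if R n then 1 else 0)" by simp
  show ?case
  proof (induction m)
    case 0
    have "chains R (Suc (Suc n)) 0 = {}" by (auto simp: chains_def)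
    then show ?case by (simp add: binomial_eq_0)
  next
    case (Suc m)
    let ?M = "if R n then m else Suc m"
    have "chains R (Suc (Suc n)) m \<inter> (\<lambda>s. s @ [m]) ` chains R (Suc n) ?M = {}"
      by (auto simp: chains_def)
    then have "card (chains R (Suc (Suc n)) (Suc m))
      = card (chains R (Suc (Suc n)) m) + card (chains R (Suc n) ?M)"
      unfolding chains_Suc_Suc by (subst card_Un_disjoint) (auto simp: finite_chains card_image inj_on_def)
    also have "\<dots> = ((Suc n + m - (?D + (if R n then 1 else 0))) choose Suc (Suc n))
        + ((n + ?M - ?D) choose Suc n)"
      using Suc outer D' by simp
    also have "\<dots> = Suc (Suc n + m - (?D + (if R n then 1 else 0))) choose Suc (Suc n)"
      using D by (auto simp: Suc_diff_le)
    also have "Suc (Suc n + m - (?D + (if R n then 1 else 0))) = Suc n + Suc m - card {i. i < Suc n \<and> R i}"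
      using D D' by auto
    finally show ?case .
  qed
qed

lemma sorts_iff_chain:
  assumes p: "p permutes {1..n}" and w: "length w = n"
  shows "sorts p w \<longleftrightarrow> (\<forall>i. Suc i < n \<longrightarrow> w ! (p (Suc i) - 1) \<le> w ! (p (Suc (Suc i)) - 1) \<and>
     (p (Suc i) > p (Suc (Suc i)) \<longrightarrow> w ! (p (Suc i) - 1) < w ! (p (Suc (Suc i)) - 1)))"
proof -
  let ?f = "\<lambda>i. pos_key w (p i)"
  have "strict_mono_on {1..n} ?f \<longleftrightarrow> (\<forall>i. Suc i < n \<longrightarrow> ?f (Suc i) < ?f (Suc (Suc i)))"
  proof
    assume "strict_mono_on {1..n} ?f"
    then show "\<forall>i. Suc i < n \<longrightarrow> ?f (Suc i) < ?f (Suc (Suc i))"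
      by (auto intro: strict_mono_onD)
  next
    assume *: "\<forall>i. Suc i < n \<longrightarrow> ?f (Suc i) < ?f (Suc (Suc i))"
    have mono: "?f i < ?f (i + Suc k)" if "1 \<le> i" "i + Suc k \<le> n" for i k
      using that
    proof (induction k)
      case 0
      then show ?case using *[rule_format, of "i - 1"] by simp
    next
      case (Suc k)
      then have "?f i < ?f (i + Suc k)" by simp
      also have "\<dots> < ?f (i + Suc (Suc k))"
        using *[rule_format, of "i + k"] Suc.prems by simp
      finally show ?case .
    qed
    show "strict_mono_on {1..n} ?f"
    proof (rule strict_mono_onI)
      fix i j assume "i \<in> {1..n}" "j \<in> {1..n}" "i < j"
      then show "?f i < ?f j" using mono[of i "j - i - 1"] by simp
    qed
  qed
  also have "\<dots> \<longleftrightarrow> (\<forall>i. Suc i < n \<longrightarrow> w ! (p (Suc i) - 1) \<le> w ! (p (Suc (Suc i)) - 1) \<and>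
     (p (Suc i) > p (Suc (Suc i)) \<longrightarrow> w ! (p (Suc i) - 1) < w ! (p (Suc (Suc i)) - 1)))"
  proof -
    have "?f (Suc i) < ?f (Suc (Suc i)) \<longleftrightarrow> w ! (p (Suc i) - 1) \<le> w ! (p (Suc (Suc i)) - 1) \<and>
     (p (Suc i) > p (Suc (Suc i)) \<longrightarrow> w ! (p (Suc i) - 1) < w ! (p (Suc (Suc i)) - 1))" if "Suc i < n" for i
    proof -
      have "p (Suc i) \<in> {1..n}" "p (Suc (Suc i)) \<in> {1..n}" "p (Suc i) \<noteq> p (Suc (Suc i))"
        using that permutes_in_image[OF p] permutes_inj[OF p] by (auto simp: inj_eq)
      then show ?thesis using pos_key_less_iff[of "p (Suc i)" w "p (Suc (Suc i))"] w by auto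
    qed
    then show ?thesis by blast
  qed
  finally show ?thesis using p w by (simp add: sorts_def)
qed

lemma card_sorted_words:
  assumes p: "p permutes {1..n}" and n: "n \<ge> 1"
  shows "card {w. set w \<subseteq> {..<m} \<and> length w = n \<and> sorts p w} = (n - 1 + m - des n p) choose n"
proof -
  let ?W = "{w. set w \<subseteq> {..<m} \<and> length w = n \<and> sorts p w}"
  let ?R = "\<lambda>i. p (Suc i) > p (Suc (Suc i))"
  let ?f = "\<lambda>w. map (\<lambda>i. w ! (p (Suc i) - 1)) [0..<n] :: nat list"
  let ?g = "\<lambda>s. map (\<lambda>j. s ! (inv p (Suc j) - 1)) [0..<n] :: nat list"
  have ran: "p (Suc i) \<in> {1..n}" "inv p (Suc i) \<in> {1..n}" if "i < n" for i
    using that permutes_in_image[OF p] permutes_in_image[OF permutes_inv[OF p]] by auto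
  have lt: "p (Suc i) - 1 < n" "inv p (Suc i) - 1 < n" "Suc (p (Suc i) - 1) = p (Suc i)"
    "Suc (inv p (Suc i) - 1) = inv p (Suc i)" if "i < n" for i
    using ran[OF that] by auto
  have gf: "?g (?f w) = w" if "length w = n" for w
    using that lt permutes_inverses[OF p] by (intro nth_equalityI) (auto simp del: One_nat_def)
  have fg: "?f (?g s) = s" if "length s = n" for s
    using that lt permutes_inverses[OF p] by (intro nth_equalityI) (auto simp del: One_nat_def)
  have sub: "set (?f w) \<subseteq> {..<m}" "set (?g w) \<subseteq> {..<m}" if "length w = n" "set w \<subseteq> {..<m}" for w
    using that lt by (auto simp del: One_nat_def simp: subset_iff)
  have chain: "sorts p w \<longleftrightarrow> (\<forall>i. Suc i < n \<longrightarrow> ?f w ! i \<le> ?f w ! Suc i \<and> (?R i \<longrightarrow> ?f w ! i < ?f w ! Suc i))"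
    if "length w = n" for w
    unfolding sorts_iff_chain[OF p that] by simp
  have "bij_betw ?f ?W (chains ?R n m)"
  proof (rule bij_betw_byWitness[where f' = ?g])
    show "?f ` ?W \<subseteq> chains ?R n m"
    proof (rule image_subsetI)
      fix w assume "w \<in> ?W"
      then show "?f w \<in> chains ?R n m"
        using sub(1)[of w] chain[of w] unfolding chains_def by simp
    qed
    show "?g ` chains ?R n m \<subseteq> ?W"
    proof (rule image_subsetI)
      fix s assume s: "s \<in> chains ?R n m"
      then have len: "length s = n" by (simp add: chains_def)
      have "length (?g s) = n" by simp
      from chain[OF this] have "sorts p (?g s)"
        unfolding fg[OF len] using s by (simp add: chains_def)
      then show "?g s \<in> ?W"
        using sub(2)[OF len] s by (simp add: chains_def)
    qed
  qed (use gf fg in \<open>auto simp: chains_def\<close>)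
  then have "card ?W = card (chains ?R n m)" by (rule bij_betw_same_card)
  also have "\<dots> = (n - 1 + m - card {i. i < n - 1 \<and> ?R i}) choose n"
    using card_chains[of ?R "n - 1" m] n by simp
  also have "card {i. i < n - 1 \<and> ?R i} = des n p"
  proof -
    have "{i \<in> {1..n-1}. p i > p (Suc i)} = Suc ` {i. i < n - 1 \<and> ?R i}"
      (is "?L = ?S")
    proof (rule set_eqI)
      fix j
      show "j \<in> ?L \<longleftrightarrow> j \<in> ?S" by (cases j) (auto simp: image_iff)
    qed
    then show ?thesis unfolding des_def by (simp add: card_image)
  qed
  finally show ?thesis .
qed

lemma finite_derangements: "finite (derangements n)"
  unfolding derangements_def by (rule finite_subset[OF _ finite_permutations[of "{1..n}"]]) auto

lemma dcoeff_eq_card: "dcoeff n k = card {p \<in> derangements n. des n p = k}"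
  unfolding dcoeff_def Dpoly_def
  by (simp add: coeff_sum coeff_monom sum.If_cases finite_derangements Int_def conj_commute eq_commute)

lemma des_less: "n \<ge> 1 \<Longrightarrow> des n p < n"
proof -
  assume "n \<ge> 1"
  have "des n p \<le> card {1..n-1}"
    unfolding des_def by (rule card_mono) auto
  with \<open>n \<ge> 1\<close> show ?thesis by simp
qed

lemma card_words_avoiding_eq_sum:
  assumes "n \<ge> 1"
  shows "card (words_avoiding n m {..<m}) = (\<Sum>k<n. dcoeff n k * ((n - 1 + m - k) choose n))"
proof -
  let ?W = "\<lambda>p. {w. set w \<subseteq> {..<m} \<and> length w = n \<and> sorts p w}"
  have avoid: "w \<in> words_avoiding n m {..<m} \<longleftrightarrow> set w \<subseteq> {..<m} \<and> length w = n \<and> \<not> (\<exists>v. fixed_letter v w)" for w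
    unfolding words_avoiding_def fixed_letter_def by auto
  have "words_avoiding n m {..<m} = (\<Union>p\<in>derangements n. ?W p)"
  proof (rule set_eqI)
    fix w
    show "w \<in> words_avoiding n m {..<m} \<longleftrightarrow> w \<in> (\<Union>p\<in>derangements n. ?W p)"
    proof
      assume "w \<in> words_avoiding n m {..<m}"
      moreover obtain p where "sorts p w" using ex1_sorts by blast
      ultimately show "w \<in> (\<Union>p\<in>derangements n. ?W p)"
        unfolding avoid derangements_def using sorts_fixed_point_iff[of p w] by (auto simp: sorts_def)
    next
      assume "w \<in> (\<Union>p\<in>derangements n. ?W p)"
      then obtain p where "p \<in> derangements n" "w \<in> ?W p" by blast
      then show "w \<in> words_avoiding n m {..<m}"
        unfolding avoid derangements_def using sorts_fixed_point_iff[of p w] by auto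
    qed
  qed
  moreover have "finite (?W p)" for p
    by (rule finite_subset[OF _ finite_lists_length_eq[of "{..<m}" n]]) auto
  moreover have "?W p \<inter> ?W q = {}" if "p \<noteq> q" for p q
    using ex1_sorts that by blast
  ultimately have "card (words_avoiding n m {..<m}) = (\<Sum>p\<in>derangements n. card (?W p))"
    by (simp add: card_UN_disjoint finite_derangements)
  also have "\<dots> = (\<Sum>p\<in>derangements n. (n - 1 + m - des n p) choose n)"
    by (intro sum.cong refl card_sorted_words) (use assms in \<open>auto simp: derangements_def\<close>)
  also have "\<dots> = (\<Sum>k<n. \<Sum>p\<in>{p \<in> derangements n. des n p = k}. (n - 1 + m - des n p) choose n)"
    by (rule sum.group[symmetric]) (use assms des_less finite_derangements in auto)
  also have "\<dots> = (\<Sum>k<n. dcoeff n k * ((n - 1 + m - k) choose n))"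
    by (intro sum.cong refl) (simp add: dcoeff_eq_card)
  finally show ?thesis .
qed

section \<open>The spiral inequalities\<close>

locale derangement_recurrence =
  fixes d :: "nat \<Rightarrow> nat \<Rightarrow> int"
  assumes one: "d 1 k = 0"
    and zero: "d n 0 = (if n = 0 then 1 else 0)"
    and rec: "d (Suc n) (Suc k) = (int k + 2) * d n (Suc k) + (int n - int k) * d n k
       + (if Suc k = n then (-1) ^ Suc n else 0)"
begin

lemma degree: "n \<ge> 1 \<Longrightarrow> k \<ge> n \<Longrightarrow> d n k = 0"
proof (induction n arbitrary: k rule: nat_induct_at_least)
  case base
  then show ?case using one by simp
next
  case (Suc n)
  show ?case
  proof (cases k)
    case (Suc k')
    with Suc.prems have "n = k' \<or> n < k'" "Suc k' \<noteq> n" by auto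
    then show ?thesis unfolding Suc rec using Suc.IH[of k'] Suc.IH[of "Suc k'"] \<open>n \<ge> 1\<close> by auto
  qed (use Suc in auto)
qed

lemma last: "n \<ge> 2 \<Longrightarrow> d n (n - 1) = (if even n then 1 else 0)"
proof (induction n rule: nat_induct_at_least)
  case base
  have "d (Suc 1) (Suc 0) = 1" unfolding rec by (simp add: one[simplified])
  then show ?case by (simp add: numeral_2_eq_2)
next
  case (Suc n)
  obtain k where k: "n = Suc (Suc k)" using Suc.hyps by (metis add_2_eq_Suc le_Suc_ex)
  show ?case using Suc.IH degree[of n n] rec[of n "Suc k"] by (auto simp: k)
qed

lemma first_pos: "n \<ge> 2 \<Longrightarrow> d n 1 > 0"
proof (induction n rule: nat_induct_at_least)
  case base
  then show ?case using last[of 2] by simp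
next
  case (Suc n)
  then show ?case using rec[of n 0] zero[of n] by (auto split: if_splits)
qed

text \<open>The weak inequality covers the exceptional pair (2, 1), where equality holds.\<close>

definition even_spiral :: "nat \<Rightarrow> bool" where
  "even_spiral n \<longleftrightarrow> (\<forall>k. 1 \<le> k \<longrightarrow> k \<le> n - 1 \<longrightarrow>
     d (2*n) (2*n - k) < d (2*n) k \<and>
     ((n, k) \<noteq> (2, 1) \<longrightarrow> d (2*n) k < d (2*n) (2*n - k - 1)) \<and> d (2*n) k \<le> d (2*n) (2*n - k - 1))"

definition odd_spiral :: "nat \<Rightarrow> bool" where
  "odd_spiral n \<longleftrightarrow> (\<forall>k. 1 \<le> k \<longrightarrow> k \<le> n - 1 \<longrightarrow>
     d (2*n+1) k < d (2*n+1) (2*n - k) \<and> d (2*n+1) (2*n - k) < d (2*n+1) (k + 1))"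

lemma even_imp_odd:
  assumes "even_spiral n"
  shows "odd_spiral n"
  unfolding odd_spiral_def
proof (intro allI impI)
  fix k assume k: "1 \<le> k" "k \<le> n - 1"
  let ?a = "d (2*n)"
  define l where "l = 2*n - k - 1"
  have l: "2*n - k = Suc l" "l \<ge> n" "l \<le> 2*n - 2" "int l = 2 * int n - int k - 1" using k by (auto simp: l_def)
  obtain j where j: "k = Suc j" using k by (cases k) auto
  have bk: "d (2*n+1) k = (int k + 1) * ?a k + (2 * int n + 1 - int k) * ?a j"
    using rec[of "2*n" j] k unfolding j by (simp add: algebra_simps)
  have bk1: "d (2*n+1) (k+1) = (int k + 2) * ?a (k+1) + (2 * int n - int k) * ?a k"
    using rec[of "2*n" k] k by (simp add: algebra_simps)
  have bl: "d (2*n+1) (2*n-k) = (int l + 2) * ?a (Suc l) + (2 * int n - int l) * ?a l"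
    using rec[of "2*n" l] l k by simp
  have 1: "?a (Suc l) < ?a k" "?a k \<le> ?a l"
    using assms k l unfolding even_spiral_def l_def by (metis, metis)
  have 2: "?a j < ?a (Suc l)"
  proof (cases j)
    case 0
    then show ?thesis using last[of "2*n"] zero[of "2*n"] k l j by simp
  next
    case (Suc i)
    then have "2 * n - j - 1 = Suc l" "(n, j) \<noteq> (2, 1)" "1 \<le> j" "j \<le> n - 1" using k j by (auto simp: l_def)
    then show ?thesis using assms unfolding even_spiral_def by metis
  qed
  have 3: "?a l \<le> ?a (k + 1)"
  proof (cases "k + 1 \<le> n - 1")
    case True
    moreover have "2 * n - (k + 1) = l" by (simp add: l_def)
    ultimately show ?thesis using assms unfolding even_spiral_def by (metis le_add2 less_imp_le)
  next
    case False
    then have "l = k + 1" using k by (auto simp: l_def)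
    then show ?thesis by simp
  qed
  have "d (2*n+1) (2*n-k) - d (2*n+1) k
     = (int k + 1) * (?a l - ?a k) + (2 * int n + 1 - int k) * (?a (Suc l) - ?a j)"
    unfolding bk bl l(4) by (simp add: algebra_simps)
  moreover have "(int k + 1) * (?a l - ?a k) \<ge> 0" "(2 * int n + 1 - int k) * (?a (Suc l) - ?a j) > 0"
    using 1 2 k by auto
  ultimately have A: "d (2*n+1) k < d (2*n+1) (2*n - k)" by linarith
  have "d (2*n+1) (k+1) - d (2*n+1) (2*n-k)
     = (int k + 1) * (?a (k+1) - ?a l) + (2 * int n - int k) * (?a k - ?a (Suc l)) + (?a (k+1) - ?a (Suc l))"
    unfolding bk1 bl l(4) by (simp add: algebra_simps)
  moreover have "(int k + 1) * (?a (k+1) - ?a l) \<ge> 0" "(2 * int n - int k) * (?a k - ?a (Suc l)) > 0"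
    using 1 3 k by auto
  ultimately have B: "d (2*n+1) (2*n - k) < d (2*n+1) (k+1)" using 1 3 by linarith
  show "d (2*n+1) k < d (2*n+1) (2*n - k) \<and> d (2*n+1) (2*n - k) < d (2*n+1) (k + 1)"
    using A B ..
qed

lemma odd_imp_even:
  assumes "odd_spiral n" "n \<ge> 1"
  shows "even_spiral (Suc n)"
  unfolding even_spiral_def
proof (intro allI impI)
  fix k assume k: "1 \<le> k" "k \<le> Suc n - 1"
  let ?b = "d (2*n+1)" and ?c = "d (2 * Suc n)"
  define l where "l = 2*n - k"
  have l: "2 * Suc n - k = l + 2" "2 * Suc n - k - 1 = l + 1" "int l = 2 * int n - int k"
    using k by (auto simp: l_def)
  obtain j where j: "k = Suc j" using k by (cases k) auto
  have ck: "?c k = (int k + 1) * ?b k + (2 * int n + 2 - int k) * ?b j"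
    using rec[of "2*n+1" j] k unfolding j by (simp add: algebra_simps)
  have cl1: "?c (l+1) = (int l + 2) * ?b (l+1) + (2 * int n + 1 - int l) * ?b l"
    using rec[of "2*n+1" l] l k by (simp add: algebra_simps l_def)
  have jl: "j = 0 \<or> ?b j < ?b (l+1)"
  proof (cases j)
    case (Suc i)
    then have "2 * n - j = l + 1" "1 \<le> j" "j \<le> n - 1" using k j by (auto simp: l_def)
    then show ?thesis using assms unfolding odd_spiral_def by metis
  qed simp
  have jl0: "?b j = 0 \<and> ?b (l+1) = 0" if "j = 0"
    using that last[of "2*n+1"] zero k assms j by (simp add: l_def)
  have jl': "?b j \<le> ?b (l+1)" using jl jl0 by auto
  have kl: "?b k < ?b l \<or> k = n \<and> ?b k = ?b l"
  proof (cases "k = n")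
    case False
    then have "1 \<le> k" "k \<le> n - 1" using k by auto
    then show ?thesis using assms unfolding odd_spiral_def l_def by metis
  qed (simp add: l_def)
  have kl': "?b k \<le> ?b l" using kl by auto
  have diff: "?c (l+1) - ?c k = (int k + 1) * (?b l - ?b k) + (2 * int n + 2 - int k) * (?b (l+1) - ?b j)"
    unfolding cl1 ck l(3) by (simp add: algebra_simps)
  have p: "(int k + 1) * (?b l - ?b k) \<ge> 0" "(2 * int n + 2 - int k) * (?b (l+1) - ?b j) \<ge> 0"
    using jl' kl' k by auto
  have p1: "(int k + 1) * (?b l - ?b k) > 0" if "?b k < ?b l" using that by auto
  have p2: "(2 * int n + 2 - int k) * (?b (l+1) - ?b j) > 0" if "?b j < ?b (l+1)" using that k by auto
  have A: "?c k \<le> ?c (l+1)" using p diff by linarith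
  have B: "?c k < ?c (l+1)" if "(Suc n, k) \<noteq> (2, 1)"
  proof -
    have "?b j < ?b (l+1) \<or> ?b k < ?b l" using jl kl that k j by auto
    then show ?thesis using p diff p1 p2 by linarith
  qed
  have C: "?c (l+2) < ?c k"
  proof (cases "j = 0")
    case True
    then have "?c (l+2) = 1" "?c k \<ge> 2"
      using last[of "2 * Suc n"] first_pos[of "2*n+1"] zero[of "2*n+1"] ck k j assms by (auto simp: l_def)
    then show ?thesis by simp
  next
    case False
    then obtain i where i: "j = Suc i" by (cases j) auto
    have cl2: "?c (l+2) = (int l + 3) * ?b (l+2) + (2 * int n - int l) * ?b (l+1)"
      using rec[of "2*n+1" "l+1"] k j i by (auto simp: algebra_simps l_def)
    have lk: "?b (l+1) < ?b k"
    proof -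
      have "2 * n - j = l + 1" "1 \<le> j" "j \<le> n - 1" "j + 1 = k" using k j i by (auto simp: l_def)
      then show ?thesis using assms unfolding odd_spiral_def by metis
    qed
    have lj: "?b (l+2) < ?b j"
    proof (cases i)
      case 0
      then have "l + 2 = 2 * n" "j = 1" using k j i by (auto simp: l_def)
      then show ?thesis
        using last[of "2*n+1"] first_pos[of "2*n+1"] assms by simp
    next
      case (Suc i')
      then have "2 * n - i = l + 2" "1 \<le> i" "i \<le> n - 1" "i + 1 = j" using k j i by (auto simp: l_def)
      then show ?thesis using assms unfolding odd_spiral_def by metis
    qed
    have "?c k - ?c (l+2) = int k * (?b k - ?b (l+1)) + (2 * int n + 2 - int k) * (?b j - ?b (l+2)) + (?b k - ?b (l+2))"
      unfolding ck cl2 l(3) by (simp add: algebra_simps)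
    moreover have "int k * (?b k - ?b (l+1)) \<ge> 0" "(2 * int n + 2 - int k) * (?b j - ?b (l+2)) \<ge> 0"
      using lk lj k by auto
    ultimately show ?thesis using lk lj jl False by linarith
  qed
  show "?c (2 * Suc n - k) < ?c k \<and> ((Suc n, k) \<noteq> (2, 1) \<longrightarrow> ?c k < ?c (2 * Suc n - k - 1)) \<and> ?c k \<le> ?c (2 * Suc n - k - 1)"
    using A B C unfolding l(2) unfolding l(1) by blast
qed

lemma spirals: "n \<ge> 1 \<Longrightarrow> even_spiral n \<and> odd_spiral n"
proof (induction n rule: nat_induct_at_least)
  case base
  have "even_spiral 1" unfolding even_spiral_def by simp
  then show ?case using even_imp_odd by simp
next
  case (Suc n)
  then show ?case using odd_imp_even even_imp_odd by blast
qed

lemma d4: "d 4 1 = 4" "d 4 2 = 4"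
  using rec[of 1 0] rec[of 1 1] rec[of 2 0] rec[of 2 1] rec[of 3 0] rec[of 3 1]
    one zero degree[of 2 2] degree[of 3 3]
  by (simp_all add: numeral_eq_Suc)

lemma unimodal_coeffs_even:
  assumes "n \<ge> 1"
  shows "i < n \<Longrightarrow> d (2*n) i \<le> d (2*n) (Suc i)"
    and "i \<ge> n \<Longrightarrow> d (2*n) (Suc i) \<le> d (2*n) i"
proof -
  let ?a = "d (2*n)"
  have sp: "?a (2*n - k) < ?a k \<and> ?a k \<le> ?a (2*n - k - 1)" if "1 \<le> k" "k \<le> n - 1" for k
    using spirals[OF assms] that unfolding even_spiral_def by blast
  have last1: "?a (2*n - 1) = 1" using last[of "2*n"] assms by simp
  {
    assume "i < n"
    then consider "i = 0" | "1 \<le> i" "i = n - 1" | "1 \<le> i" "Suc i \<le> n - 1" by linarith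
    then show "?a i \<le> ?a (Suc i)"
    proof cases
      case 1
      then show ?thesis using zero[of "2*n"] first_pos[of "2*n"] assms by simp
    next
      case 2
      then have "2 * n - i - 1 = Suc i" by linarith
      then show ?thesis using sp[of i] 2 by simp
    next
      case 3
      then have "2 * n - i - 1 = 2 * n - Suc i" by linarith
      then show ?thesis using sp[of i] sp[of "Suc i"] 3 by simp
    qed
  }
  {
    assume "i \<ge> n"
    then consider "i \<ge> 2*n - 1" | "n \<le> i" "i \<le> 2*n - 2" by linarith
    then show "?a (Suc i) \<le> ?a i"
    proof cases
      case 1
      then have "?a (Suc i) = 0" using assms degree[of "2*n" "Suc i"] by simp
      moreover have "?a i \<ge> 0"
        using 1 last1 degree[of "2*n" i] assms by (cases "i = 2*n - 1") auto
      ultimately show ?thesis by simp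
    next
      case 2
      define k where "k = 2*n - Suc i"
      have "1 \<le> k" "k \<le> n - 1" "2*n - k = Suc i" "2*n - k - 1 = i" using 2 assms by (auto simp: k_def)
      then show ?thesis using sp[of k] by simp
    qed
  }
qed

lemma unimodal_coeffs_odd:
  assumes "n \<ge> 1"
  shows "i < n \<Longrightarrow> d (2*n+1) i \<le> d (2*n+1) (Suc i)"
    and "i \<ge> n \<Longrightarrow> d (2*n+1) (Suc i) \<le> d (2*n+1) i"
proof -
  let ?b = "d (2*n+1)"
  have sp: "?b k < ?b (2*n - k) \<and> ?b (2*n - k) < ?b (k + 1)" if "1 \<le> k" "k \<le> n - 1" for k
    using spirals[OF assms] that unfolding odd_spiral_def by blast
  have high: "?b i = 0" if "i \<ge> 2*n" for i
    using last[of "2*n+1"] degree[of "2*n+1" i] assms that by (cases "i = 2*n") auto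
  {
    assume "i < n"
    then show "?b i \<le> ?b (Suc i)"
      using sp[of i] zero[of "2*n+1"] first_pos[of "2*n+1"] assms by (cases "i = 0") force+
  }
  {
    assume "i \<ge> n"
    then consider "i \<ge> 2*n" | "i = n" "n = 1" | "i = n" "n \<ge> 2" | "i = 2*n - 1" "n \<ge> 2" | "Suc n \<le> i" "i \<le> 2*n - 2" by linarith
    then show "?b (Suc i) \<le> ?b i"
    proof cases
      case 1
      then show ?thesis using high by simp
    next
      case 2
      then show ?thesis using high[of 2] first_pos[of 3] by (simp add: numeral_2_eq_2 numeral_3_eq_3)
    next
      case 3
      then have "1 \<le> n - 1" "2 * n - (n - 1) = Suc i" "n - 1 + 1 = i" by auto
      then show ?thesis using sp[of "n - 1"] by simp
    next
      case 4
      then have "1 \<le> n - 1" "Suc i = 2 * n" by auto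
      then show ?thesis using 4 sp[of 1] first_pos[of "2*n+1"] high[of "2*n"] by simp
    next
      case 5
      define k where "k = 2*n - Suc i"
      have "1 \<le> k" "Suc k \<le> n - 1" "2*n - k = Suc i" "2*n - Suc k = i" using 5 by (auto simp: k_def)
      then show ?thesis using sp[of k] sp[of "Suc k"] by simp
    qed
  }
qed

end

section \<open>The recurrence for derangements by descents\<close>

lemma mult_binomial_eq:
  assumes "k < n"
  shows "int m * int ((n - 1 + m - k) choose n)
    = int (k + 1) * int ((n + m - k) choose Suc n) + int (n - k) * int ((n + m - Suc k) choose Suc n)"
proof -
  define N where "N = n - 1 + m - k"
  have N: "n + m - k = Suc N" "n + m - Suc k = N" "int N = int n - 1 + int m - int k"
    using assms by (auto simp: N_def)
  have absorb: "int (Suc n) * int (N choose Suc n) = (int N - int n) * int (N choose n)"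
  proof (cases "n \<le> N")
    case True
    have "Suc n * (N choose Suc n) = (N - n) * (N choose n)"
      using binomial_absorb_comp[of N n] binomial_absorption[of n N] by simp
    then show ?thesis using True by (metis of_nat_diff of_nat_mult)
  qed (simp add: binomial_eq_0)
  have "int (k + 1) * int (Suc N choose Suc n) + int (n - k) * int (N choose Suc n)
     = int (k + 1) * int (N choose n) + int (Suc n) * int (N choose Suc n)"
    using assms by (simp add: algebra_simps of_nat_diff)
  also have "\<dots> = int m * int (N choose n)"
    unfolding absorb N(3) by (simp add: algebra_simps)
  finally show ?thesis unfolding N(1,2) by (simp add: N_def)
qed

lemma binomial_combination_eq_0:
  fixes x :: "nat \<Rightarrow> int"
  assumes "\<And>m. (\<Sum>k<Suc n. x k * int ((n + m - k) choose Suc n)) = 0" and "k \<le> n"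
  shows "x k = 0"
  using assms(2)
proof (induction k rule: less_induct)
  case (less k)
  have "0 = (\<Sum>j<Suc n. x j * int ((n + Suc k - j) choose Suc n))"
    using assms(1)[of "Suc k"] by simp
  also have "\<dots> = (\<Sum>j<Suc n. if j = k then x k else 0)"
  proof (rule sum.cong)
    fix j assume "j \<in> {..<Suc n}"
    then consider "j < k" | "j = k" | "k < j" "j \<le> n" by fastforce
    then show "x j * int ((n + Suc k - j) choose Suc n) = (if j = k then x k else 0)"
    proof cases
      case 1
      then show ?thesis using less by simp
    next
      case 3
      then have "n + Suc k - j < Suc n" by simp
      then show ?thesis using 3 by (simp add: binomial_eq_0)
    qed simp
  qed simp
  also have "\<dots> = x k" using less.prems by simp
  finally show ?case by simp
qed

lemma dcoeff_eq_0: "1 \<le> n \<Longrightarrow> n \<le> k \<Longrightarrow> dcoeff n k = 0"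
proof -
  assume "1 \<le> n" "n \<le> k"
  then have "des n p \<noteq> k" for p using des_less[of n p] by simp
  then have "{p \<in> derangements n. des n p = k} = {}" by simp
  then show ?thesis by (simp only: dcoeff_eq_card card.empty)
qed

lemma dcoeff_rec_aux:
  assumes n: "1 \<le> n" and k: "k \<le> n"
  shows "int (dcoeff (Suc n) k) = int (k + 1) * int (dcoeff n k)
     + (if k = 0 then 0 else int (Suc n - k) * int (dcoeff n (k - 1))) + (if k = n then (-1) ^ Suc n else 0)"
proof -
  let ?u = "\<lambda>k. int (k + 1) * int (dcoeff n k)"
  let ?v = "\<lambda>k. if k = 0 then 0 else int (Suc n - k) * int (dcoeff n (k - 1))"
  let ?w = "\<lambda>k. if k = n then (-1) ^ Suc n else 0 :: int"
  let ?C = "\<lambda>m k. int ((n + m - k) choose Suc n)"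
  have "(\<Sum>k<Suc n. (int (dcoeff (Suc n) k) - (?u k + ?v k + ?w k)) * ?C m k) = 0" for m
  proof -
    have "(\<Sum>k<Suc n. int (dcoeff (Suc n) k) * ?C m k) = int (card (words_avoiding (Suc n) m {..<m}))"
      using card_words_avoiding_eq_sum[of "Suc n" m] by simp
    also have "\<dots> = int m * int (card (words_avoiding n m {..<m})) + (-1) ^ Suc n * int (m choose Suc n)"
      using card_words_avoiding_rec[of "{..<m}" m n] by simp
    also have "int m * int (card (words_avoiding n m {..<m}))
      = (\<Sum>k<n. int (dcoeff n k) * (int m * int ((n - 1 + m - k) choose n)))"
      unfolding card_words_avoiding_eq_sum[OF n] by (simp add: sum_distrib_left mult_ac)
    also have "\<dots> = (\<Sum>k<n. ?u k * ?C m k + int (n - k) * int (dcoeff n k) * ?C m (Suc k))"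
      by (intro sum.cong refl) (subst mult_binomial_eq, auto simp: algebra_simps)
    also have "\<dots> = (\<Sum>k<n. ?u k * ?C m k) + (\<Sum>k<n. int (n - k) * int (dcoeff n k) * ?C m (Suc k))"
      by (rule sum.distrib)
    also have "(\<Sum>k<n. ?u k * ?C m k) = (\<Sum>k<Suc n. ?u k * ?C m k)"
      using dcoeff_eq_0[OF n, of n] by simp
    also have "(\<Sum>k<n. int (n - k) * int (dcoeff n k) * ?C m (Suc k)) = (\<Sum>k<Suc n. ?v k * ?C m k)"
      by (subst sum.lessThan_Suc_shift) simp
    also have "(-1) ^ Suc n * int (m choose Suc n) = (\<Sum>k<Suc n. ?w k * ?C m k)"
    proof -
      have "(\<Sum>k<Suc n. ?w k * ?C m k) = (\<Sum>k<Suc n. if k = n then (-1) ^ Suc n * ?C m n else 0)"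
        by (rule sum.cong) auto
      then show ?thesis by simp
    qed
    finally have "(\<Sum>k<Suc n. int (dcoeff (Suc n) k) * ?C m k)
      = (\<Sum>k<Suc n. ?u k * ?C m k) + (\<Sum>k<Suc n. ?v k * ?C m k) + (\<Sum>k<Suc n. ?w k * ?C m k)" .
    then show ?thesis
      by (simp only: left_diff_distrib distrib_right sum_subtractf sum.distrib)
  qed
  from binomial_combination_eq_0[OF this k] show ?thesis by simp
qed

lemma dcoeff_0: "dcoeff 0 k = (if k = 0 then 1 else 0)"
proof -
  have "derangements 0 = {id}" by (auto simp: derangements_def)
  then show ?thesis by (simp add: dcoeff_def Dpoly_def des_def coeff_monom)
qed

lemma dcoeff_1: "dcoeff 1 k = 0"
proof -
  have "derangements 1 = {}" by (auto simp: derangements_def dest: permutes_in_image[of _ "{1}" 1])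
  then show ?thesis by (simp add: dcoeff_def Dpoly_def)
qed

lemma dcoeff_rec:
  "int (dcoeff (Suc n) (Suc k)) = (int k + 2) * int (dcoeff n (Suc k)) + (int n - int k) * int (dcoeff n k)
     + (if Suc k = n then (-1) ^ Suc n else 0)"
proof -
  consider "n = 0" | "1 \<le> n" "Suc k \<le> n" | "1 \<le> n" "n < Suc k" by linarith
  then show ?thesis
  proof cases
    case 1
    then show ?thesis using dcoeff_1 by (simp add: dcoeff_0)
  next
    case 2
    then show ?thesis using dcoeff_rec_aux[of n "Suc k"] by (simp add: of_nat_diff algebra_simps)
  next
    case 3
    then show ?thesis by (simp add: dcoeff_eq_0)
  qed
qed

lemma dcoeff_at_0: "dcoeff n 0 = (if n = 0 then 1 else 0)"
proof (cases n)
  case (Suc n')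
  have "dcoeff (Suc n') 0 = 0"
  proof (induction n')
    case 0
    then show ?case using dcoeff_1 by simp
  next
    case (Suc n')
    then show ?case using dcoeff_rec_aux[of "Suc n'" 0] by simp
  qed
  then show ?thesis using Suc by simp
qed (simp add: dcoeff_0)

interpretation derangement_recurrence "\<lambda>n k. int (dcoeff n k)"
  by unfold_locales (use dcoeff_1 dcoeff_at_0 dcoeff_rec in auto)

lemma unimodal_Dpoly:
  assumes "n \<ge> 2"
  shows "unimodal (Dpoly n)"
proof -
  obtain m where "m \<ge> 1" "n = 2 * m \<or> n = 2 * m + 1"
    using assms by (intro that[of "n div 2"]) presburger+
  then show ?thesis
    using unimodal_coeffs_even[of m] unimodal_coeffs_odd[of m]
    unfolding unimodal_def dcoeff_def[symmetric] of_nat_le_iff by blast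
qed

theorem theorem1p2:
  shows "(\<forall>n\<ge>1. \<forall>k. 1 \<le> k \<and> k \<le> n - 1 \<longrightarrow>
            dcoeff (2*n) (2*n - k) < dcoeff (2*n) k
          \<and> ((n, k) \<noteq> (2, 1) \<longrightarrow> dcoeff (2*n) k < dcoeff (2*n) (2*n - k - 1))
          \<and> dcoeff (2*n+1) k < dcoeff (2*n+1) (2*n - k)
          \<and> dcoeff (2*n+1) (2*n - k) < dcoeff (2*n+1) (k + 1))
       \<and> dcoeff 4 1 = 4 \<and> dcoeff 4 2 = 4
       \<and> (\<forall>n\<ge>2. unimodal (Dpoly n))"
proof (intro conjI allI impI)
  fix n k :: nat
  assume "1 \<le> n" "1 \<le> k \<and> k \<le> n - 1"
  with spirals[of n] show "dcoeff (2*n) (2*n - k) < dcoeff (2*n) k"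
    "(n, k) \<noteq> (2, 1) \<Longrightarrow> dcoeff (2*n) k < dcoeff (2*n) (2*n - k - 1)"
    "dcoeff (2*n+1) k < dcoeff (2*n+1) (2*n - k)"
    "dcoeff (2*n+1) (2*n - k) < dcoeff (2*n+1) (k + 1)"
    unfolding even_spiral_def odd_spiral_def of_nat_less_iff by blast+
next
  show "dcoeff 4 1 = 4" "dcoeff 4 2 = 4" using d4 by simp_all
next
  fix n :: nat assume "n \<ge> 2"
  then show "unimodal (Dpoly n)" by (rule unimodal_Dpoly)
qed

end
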